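(* Let $n_1,n_2,m$ be positive integers with $1\le n_i\le m$ for $i\in\{1,2\}$ and $n=n_1+n_2$. Let $\mathcal{S}_i$ be an $\mathbb{F}_{q^m}$-representation of $\mathcal{U}_{1,n_i}(q)$ for each $i\in\{1,2\}$, let $X\in\mathbb{F}_{q^m}^{1\times n_2}$, and let $\mathcal{S}:=\mathcal{S}_1\square_X\mathcal{S}_2$. The following are equivalent. (i) $(\mathcal{S},r_{\mathcal{S}})$ is an $\mathbb{F}_{q^m}$-representation of $\mathcal{U}_{1,n_1}(q)\square\,\mathcal{U}_{1,n_2}(q)$. (ii) $L_{\mathcal{S}}$ is an $n_1$-club of rank $n$ in $\mathrm{PG}(1,q^m)$.
   Context: A $q$-matroid $M=(E,r)$ on a finite-dimensional $\mathbb{F}_q$-space $E$ is given by an integer-valued function $r$ on the subspaces of $E$ with (R1) $0\le r(A)\le\dim(A)$; (R2) $A\le B\Rightarrow r(A)\le r(B)$; (R3) $r(A+B)+r(A\cap B)\le r(A)+r(B)$. $A$ is independent if $r(A)=\dim A$. Isomorphism means a rank-preserving $\mathbb{F}_q$-linear isomorphism of ground spaces. $\mathcal{U}_{k,n}(q)$ is the $q$-matroid on $\mathbb{F}_q^n$ with rank function $A\mapsto\min\{k,\dim A\}$. An $[n,k]_{q^m/q}$ system is an $n$-dimensional $\mathbb{F}_q$-subspace $\mathcal{S}$ of $\mathbb{F}_{q^m}^k$ with $\langle\mathcal{S}\rangle_{\mathbb{F}_{q^m}}=\mathbb{F}_{q^m}^k$. For $V\le\mathcal{S}$ an $\mathbb{F}_q$-subspace,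 $r_{\mathcal{S}}(V)=\dim_{\mathbb{F}_{q^m}}\langle V\rangle_{\mathbb{F}_{q^m}}$; $(\mathcal{S},r_{\mathcal{S}})$ is a $q$-matroid. $\mathcal{S}$ (or $(\mathcal{S},r_{\mathcal{S}})$) is an $\mathbb{F}_{q^m}$-representation of a rank-$k$ $q$-matroid $M$ with $n$-dimensional ground space if $M\cong(\mathcal{S},r_{\mathcal{S}})$. Given an $[n_1,1]_{q^m/q}$ system $\mathcal{S}_1$, an $[n_2,1]_{q^m/q}$ system $\mathcal{S}_2$ with a fixed $\mathbb{F}_q$-basis $w_1,\dots,w_{n_2}$, and $X=(x_1,\dots,x_{n_2})\in\mathbb{F}_{q^m}^{1\times n_2}$, let $\mathcal{S}_1\square_X\mathcal{S}_2=\{(u,0):u\in\mathcal{S}_1\}+\langle(x_1,w_1),\dots,(x_{n_2},w_{n_2})\rangle_{\mathbb{F}_q}\le\mathbb{F}_{q^m}^{2}$, an $[n_1+n_2,2]_{q^m/q}$ system. For a $[n,2]_{q^m/q}$ system $\mathcal{S}$, the linear set of $\mathcal{S}$, of rank $n=\dim_{\mathbb{F}_q}(\mathcal{S})$, is $L_{\mathcal{S}}=\{\langle v\rangle_{\mathbb{F}_{q^m}}:v\in\mathcal{S}\setminus\{0\}\}\subseteq\mathrm{PG}(1,q^m)$; the weight of a point $\langle v\rangle_{\mathbb{F}_{q^m}}$ is $\dim_{\mathbb{F}_q}(\mathcal{S}\cap\langle v\rangle_{\mathbb{F}_{q^m}})$. An $i$-club of rank $n$ in $\mathrm{PG}(1,q^m)$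 is a linear set $L_{\mathcal{S}}$ of rank $n$ in which one point has weight $i$ and all other points have weight one (so for $i=1$ all points have weight one). Free product: for $q$-matroids $M_i=(E_i,r_i)$, $i=1,2$, with projections $\pi_i:E_1\oplus E_2\to E_i$ and embeddings $\iota_i:E_i\to E_1\oplus E_2$, put $\lambda_1(A)=r_1(E_1)-r_1(A)$ and $\nu_2(B)=\dim(B)-r_2(B)$. $M_1\square M_2$ is the $q$-matroid on $E_1\oplus E_2$ whose independent spaces are exactly the $I\le E_1\oplus E_2$ with $\pi_1(I\cap\iota_1(E_1))$ independent in $M_1$ and $\lambda_1(\pi_1(I\cap\iota_1(E_1)))\ge\nu_2(\pi_2(I))$. *)

theory Defs
  imports "HOL-Analysis.Analysis"
begin

section \<open>q-matroids\<close>

text \<open>The finite field of order q is the type \<open>'k\<close>. The ground space is a subspace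
  of the ambient \<open>'k\<close>-space \<open>'v\<close>; only the values of the rank function on subspaces
  of the ground space are meaningful.\<close>

record ('k, 'v) qmat =
  qscale :: "'k \<Rightarrow> 'v \<Rightarrow> 'v"
  ground :: "'v set"
  rk :: "'v set \<Rightarrow> int"

definition subspaces :: "('k::field, 'v::ab_group_add) qmat \<Rightarrow> 'v set set" where
  "subspaces M = {A. module.subspace (qscale M) A \<and> A \<subseteq> ground M}"

abbreviation qdim :: "('k::field, 'v::ab_group_add) qmat \<Rightarrow> 'v set \<Rightarrow> nat" where
  "qdim M \<equiv> vector_space.dim (qscale M)"

definition q_matroid :: "('k::{field,finite}, 'v::ab_group_add) qmat \<Rightarrow> bool" where
  "q_matroid M \<longleftrightarrow>
     vector_space (qscale M) \<and>
     (\<exists>B. finite B \<and> ground M = module.span (qscale M) B) \<and>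
     (\<forall>A\<in>subspaces M. 0 \<le> rk M A \<and> rk M A \<le> int (qdim M A)) \<and>
     (\<forall>A\<in>subspaces M. \<forall>B\<in>subspaces M. A \<subseteq> B \<longrightarrow> rk M A \<le> rk M B) \<and>
     (\<forall>A\<in>subspaces M. \<forall>B\<in>subspaces M.
        rk M {a + b | a b. a \<in> A \<and> b \<in> B} + rk M (A \<inter> B) \<le> rk M A + rk M B)"

definition indep :: "('k::field, 'v::ab_group_add) qmat \<Rightarrow> 'v set \<Rightarrow> bool" where
  "indep M A \<longleftrightarrow> A \<in> subspaces M \<and> rk M A = int (qdim M A)"

definition qmat_iso ::
  "('k::field, 'v::ab_group_add) qmat \<Rightarrow> ('k, 'w::ab_group_add) qmat \<Rightarrow> bool" where
  "qmat_iso M N \<longleftrightarrow> (\<exists>f.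
     bij_betw f (ground M) (ground N) \<and>
     (\<forall>x\<in>ground M. \<forall>y\<in>ground M. f (x + y) = f x + f y) \<and>
     (\<forall>c. \<forall>x\<in>ground M. f (qscale M c x) = qscale N c (f x)) \<and>
     (\<forall>A\<in>subspaces M. rk N (f ` A) = rk M A))"

definition uniform :: "nat \<Rightarrow> ('k::{field,finite}, 'k ^ 'n) qmat" where
  "uniform k = \<lparr>qscale = (*s), ground = UNIV, rk = (\<lambda>A. int (min k (vec.dim A)))\<rparr>"


section \<open>The free product\<close>

definition lam :: "('k::field, 'v::ab_group_add) qmat \<Rightarrow> 'v set \<Rightarrow> int" where
  "lam M A = rk M (ground M) - rk M A"

definition nullity :: "('k::field, 'v::ab_group_add) qmat \<Rightarrow> 'v set \<Rightarrow> int" where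
  "nullity M B = int (qdim M B) - rk M B"

definition dsum_scale ::
  "('k::field, 'v::ab_group_add) qmat \<Rightarrow> ('k, 'w::ab_group_add) qmat \<Rightarrow> 'k \<Rightarrow> 'v \<times> 'w \<Rightarrow> 'v \<times> 'w"
  where "dsum_scale M1 M2 = module_prod.scale (qscale M1) (qscale M2)"

definition free_indep ::
  "('k::field, 'v::ab_group_add) qmat \<Rightarrow> ('k, 'w::ab_group_add) qmat \<Rightarrow> ('v \<times> 'w) set \<Rightarrow> bool" where
  "free_indep M1 M2 I \<longleftrightarrow>
     module.subspace (dsum_scale M1 M2) I \<and> I \<subseteq> ground M1 \<times> ground M2 \<and>
     (let J = fst ` (I \<inter> (\<lambda>x. (x, 0)) ` ground M1)
      in indep M1 J \<and> lam M1 J \<ge> nullity M2 (snd ` I))"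

text \<open>A q-matroid is determined by its independent spaces: the rank of \<open>A\<close> is the largest
  dimension of an independent subspace of \<open>A\<close>. Lemma \<open>indep_free_product\<close> below shows that
  the independent spaces of the structure so defined are exactly the prescribed ones, and
  \<open>rk_free_product_unique\<close> that no other rank function of a q-matroid has this property.\<close>

definition free_product ::
  "('k::field, 'v::ab_group_add) qmat \<Rightarrow> ('k, 'w::ab_group_add) qmat \<Rightarrow> ('k, 'v \<times> 'w) qmat"
  where
  "free_product M1 M2 =
     \<lparr>qscale = dsum_scale M1 M2,
      ground = ground M1 \<times> ground M2,
      rk = (\<lambda>A. int (Max {vector_space.dim (dsum_scale M1 M2) I | I.
                            I \<subseteq> A \<and> free_indep M1 M2 I}))\<rparr>"


section \<open>Systems and representations\<close>

text \<open>The field with \<open>q\<^sup>m\<close> elements is a type \<open>'l\<close> containing \<open>'k\<close> through a field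
  embedding.\<close>

definition field_embedding :: "('k::field \<Rightarrow> 'l::field) \<Rightarrow> bool" where
  "field_embedding \<phi> \<longleftrightarrow>
     \<phi> 1 = 1 \<and> (\<forall>x y. \<phi> (x + y) = \<phi> x + \<phi> y) \<and> (\<forall>x y. \<phi> (x * y) = \<phi> x * \<phi> y)"

definition res_scale :: "('k::field \<Rightarrow> 'l::field) \<Rightarrow> 'k \<Rightarrow> 'l ^ 'r \<Rightarrow> 'l ^ 'r" where
  "res_scale \<phi> c v = \<phi> c *s v"

definition is_system :: "('k::field \<Rightarrow> 'l::field) \<Rightarrow> nat \<Rightarrow> ('l ^ 'r) set \<Rightarrow> bool" where
  "is_system \<phi> n S \<longleftrightarrow>
     module.subspace (res_scale \<phi>) S \<and> vector_space.dim (res_scale \<phi>) S = n \<and>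
     vec.span S = UNIV"

definition system_qmat :: "('k::field \<Rightarrow> 'l::field) \<Rightarrow> ('l ^ 'r) set \<Rightarrow> ('k, 'l ^ 'r) qmat" where
  "system_qmat \<phi> S =
     \<lparr>qscale = res_scale \<phi>, ground = S, rk = (\<lambda>V. int (vec.dim (vec.span V)))\<rparr>"

definition represents ::
  "('k::{field,finite} \<Rightarrow> 'l::field) \<Rightarrow> ('l ^ 'r) set \<Rightarrow> ('k, 'v::ab_group_add) qmat \<Rightarrow> bool" where
  "represents \<phi> S M \<longleftrightarrow>
     q_matroid M \<and> rk M (ground M) = int CARD('r) \<and>
     is_system \<phi> (qdim M (ground M)) S \<and> qmat_iso M (system_qmat \<phi> S)"

definition is_basis ::
  "('k::field \<Rightarrow> 'l::field) \<Rightarrow> ('l ^ 'r) set \<Rightarrow> ('n \<Rightarrow> 'l ^ 'r) \<Rightarrow> bool" where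
  "is_basis \<phi> S w \<longleftrightarrow>
     inj w \<and> \<not> module.dependent (res_scale \<phi>) (range w) \<and>
     module.span (res_scale \<phi>) (range w) = S"

text \<open>The second system enters only through its chosen basis \<open>w\<close>.\<close>

definition box_system ::
  "('k::field \<Rightarrow> 'l::field) \<Rightarrow> ('l ^ 1) set \<Rightarrow> 'l ^ 'n ^ 1 \<Rightarrow> ('n \<Rightarrow> 'l ^ 1) \<Rightarrow> ('l ^ 2) set" where
  "box_system \<phi> S1 X w =
     {a + b | a b. a \<in> {vector [u $ 1, 0] | u. u \<in> S1} \<and>
                   b \<in> module.span (res_scale \<phi>) (range (\<lambda>j. vector [X $ 1 $ j, w j $ 1]))}"


section \<open>Linear sets on the projective line\<close>

definition linear_set :: "('l::field ^ 2) set \<Rightarrow> ('l ^ 2) set set" where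
  "linear_set S = {vec.span {v} | v. v \<in> S - {0}}"

definition weight :: "('k::field \<Rightarrow> 'l::field) \<Rightarrow> ('l ^ 2) set \<Rightarrow> ('l ^ 2) set \<Rightarrow> nat" where
  "weight \<phi> S P = vector_space.dim (res_scale \<phi>) (S \<inter> P)"

definition is_club :: "('k::field \<Rightarrow> 'l::field) \<Rightarrow> nat \<Rightarrow> nat \<Rightarrow> ('l ^ 2) set \<Rightarrow> bool" where
  "is_club \<phi> i n S \<longleftrightarrow>
     is_system \<phi> n S \<and>
     (\<exists>P\<in>linear_set S. weight \<phi> S P = i \<and>
        (\<forall>Q\<in>linear_set S. Q \<noteq> P \<longrightarrow> weight \<phi> S Q = 1))"


section \<open>Consistency of the definitions\<close>

lemma q_matroid_uniform: "q_matroid (uniform k :: ('k::{field,finite}, 'k ^ 'n) qmat)"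
proof -
  let ?U = "uniform k :: ('k, 'k ^ 'n) qmat"
  have sub: "int (min k (vec.dim {a + b |a b. a \<in> A \<and> b \<in> B})) + int (min k (vec.dim (A \<inter> B)))
      \<le> int (min k (vec.dim A)) + int (min k (vec.dim B))"
    if "vec.subspace A" "vec.subspace B" for A B :: "('k ^ 'n) set"
  proof -
    have "vec.dim {a + b |a b. a \<in> A \<and> b \<in> B} + vec.dim (A \<inter> B) = vec.dim A + vec.dim B"
      using vec.dim_sums_Int[OF that] by simp
    moreover have "vec.dim (A \<inter> B) \<le> vec.dim A" "vec.dim (A \<inter> B) \<le> vec.dim B"
      by (auto intro: vec.dim_subset)
    ultimately show ?thesis by linarith
  qed
  have "vector_space ((*s) :: 'k \<Rightarrow> 'k ^ 'n \<Rightarrow> _)" by unfold_locales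
  moreover have "\<exists>B :: ('k ^ 'n) set. finite B \<and> UNIV = vec.span B"
    by (rule exI[of _ UNIV]) simp
  moreover have "min k (vec.dim A) \<le> min k (vec.dim B)" if "A \<subseteq> B" for A B :: "('k ^ 'n) set"
    using vec.dim_subset[OF that] by linarith
  ultimately show ?thesis
    using sub by (auto simp: q_matroid_def uniform_def subspaces_def simp del: of_nat_min)
qed

lemma vector_space_res_scale:
  assumes "field_embedding \<phi>"
  shows "vector_space (res_scale \<phi> :: _ \<Rightarrow> 'l::field ^ 'r \<Rightarrow> _)"
  using assms unfolding field_embedding_def
  by unfold_locales
     (auto simp: res_scale_def vec.scale_right_distrib vec.scale_left_distrib)

lemma q_matroid_vector_space: "q_matroid M \<Longrightarrow> vector_space (qscale M)"
  unfolding q_matroid_def by (elim conjE)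

lemma q_matroid_ground: "q_matroid M \<Longrightarrow> \<exists>B. finite B \<and> ground M = module.span (qscale M) B"
  unfolding q_matroid_def by (elim conjE)

lemma q_matroid_rk_bounds:
  "q_matroid M \<Longrightarrow> A \<in> subspaces M \<Longrightarrow> 0 \<le> rk M A \<and> rk M A \<le> int (qdim M A)"
  unfolding q_matroid_def by (elim conjE) (rule bspec)

lemma q_matroid_rk_mono:
  "q_matroid M \<Longrightarrow> A \<in> subspaces M \<Longrightarrow> B \<in> subspaces M \<Longrightarrow> A \<subseteq> B \<Longrightarrow> rk M A \<le> rk M B"
  unfolding q_matroid_def by (elim conjE) (drule (1) bspec, drule (1) bspec, erule (1) mp)

lemma q_matroid_rk_submodular:
  "q_matroid M \<Longrightarrow> A \<in> subspaces M \<Longrightarrow> B \<in> subspaces M \<Longrightarrow>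
     rk M {a + b | a b. a \<in> A \<and> b \<in> B} + rk M (A \<inter> B) \<le> rk M A + rk M B"
  unfolding q_matroid_def by (elim conjE) (drule (1) bspec, erule (1) bspec)

lemma q_matroid_finite:
  fixes M :: "('k::{field,finite}, 'v::ab_group_add) qmat"
  assumes "q_matroid M"
  shows "finite (ground M)"
proof -
  interpret vector_space "qscale M" using assms by (rule q_matroid_vector_space)
  obtain B where B: "finite B" "ground M = span B" using q_matroid_ground[OF assms] by blast
  let ?s = "\<lambda>u. \<Sum>b\<in>B. qscale M (u b) b"
  have "ground M \<subseteq> ?s ` (B \<rightarrow>\<^sub>E UNIV)"
  proof
    fix x assume "x \<in> ground M"
    then obtain u where "x = ?s u" unfolding B(2) span_finite[OF B(1)] by blast
    also have "\<dots> = ?s (restrict u B)" by (rule sum.cong) simp_all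
    finally show "x \<in> ?s ` (B \<rightarrow>\<^sub>E UNIV)" by (rule image_eqI[of _ ?s "restrict u B"]) (simp add: restrict_PiE_iff)
  qed
  moreover have "finite (?s ` (B \<rightarrow>\<^sub>E UNIV))"
    using B(1) by (intro finite_imageI finite_PiE) simp_all
  ultimately show ?thesis by (rule finite_subset)
qed

lemma (in vector_space) dim_mono_finite:
  assumes "finite A" "I \<subseteq> A" shows "dim I \<le> dim A"
proof -
  obtain B where B: "B \<subseteq> I" "independent B" "I \<subseteq> span B" "card B = dim I"
    using basis_exists by blast
  obtain C where C: "C \<subseteq> A" "independent C" "A \<subseteq> span C" "card C = dim A"
    using basis_exists by blast
  have "finite C" using C(1) assms(1) by (rule finite_subset)
  then have "card B \<le> card C"
    using independent_span_bound[of C B] B(1,2) C(3) assms(2) by (meson subset_trans)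
  then show ?thesis using B C by simp
qed

lemma vector_space_dsum_scale:
  assumes "vector_space (qscale M1)" "vector_space (qscale M2)"
  shows "vector_space (dsum_scale M1 M2)"
proof -
  interpret v1: vector_space "qscale M1" by fact
  interpret v2: vector_space "qscale M2" by fact
  interpret vector_space_prod "qscale M1" "qscale M2" ..
  show ?thesis unfolding dsum_scale_def by (rule p.vector_space_axioms)
qed

lemma free_indep_0:
  assumes "q_matroid M1" "q_matroid M2"
  shows "free_indep M1 M2 {0}"
proof -
  interpret v1: vector_space "qscale M1" using assms by (blast intro: q_matroid_vector_space)
  interpret v2: vector_space "qscale M2" using assms by (blast intro: q_matroid_vector_space)
  interpret p: vector_space "dsum_scale M1 M2"
    by (rule vector_space_dsum_scale) (unfold_locales)
  have g1: "v1.subspace (ground M1)" and g2: "v2.subspace (ground M2)"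
    using q_matroid_ground[OF assms(1)] q_matroid_ground[OF assms(2)] by auto
  have d: "v1.dim {0} = 0" "v2.dim {0} = 0"
    using v1.dim_span[of "{}"] v2.dim_span[of "{}"]
      v1.dim_eq_card_independent[OF v1.independent_empty]
      v2.dim_eq_card_independent[OF v2.independent_empty] by simp_all
  have s: "{0} \<in> subspaces M1" "{0} \<in> subspaces M2" "ground M1 \<in> subspaces M1"
    using g1 g2 v1.subspace_0 v2.subspace_0 by (auto simp: subspaces_def)
  have b1: "0 \<le> rk M1 A \<and> rk M1 A \<le> int (v1.dim A)" if "A \<in> subspaces M1" for A
    using assms(1) that by (rule q_matroid_rk_bounds)
  have b2: "0 \<le> rk M2 A \<and> rk M2 A \<le> int (v2.dim A)" if "A \<in> subspaces M2" for A
    using assms(2) that by (rule q_matroid_rk_bounds)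
  have r: "rk M1 {0} = 0" "rk M2 {0} = 0" "rk M1 (ground M1) \<ge> 0"
    using b1[OF s(1)] b2[OF s(2)] b1[OF s(3)] d by simp_all
  have z: "0 \<in> ground M1" "0 \<in> ground M2"
    using v1.subspace_0[OF g1] v2.subspace_0[OF g2] .
  have J: "fst ` ({0} \<inter> (\<lambda>x. (x, 0)) ` ground M1) = {0}"
    using z(1) by (force simp: zero_prod_def image_iff)
  have "indep M1 {0}" "nullity M2 {0} \<le> lam M1 {0}"
    using s r d by (simp_all add: indep_def lam_def nullity_def)
  moreover have "p.subspace {0}" "{0} \<subseteq> ground M1 \<times> ground M2"
    using z by (simp_all add: zero_prod_def[symmetric] mem_Times_iff)
  ultimately show ?thesis
    unfolding free_indep_def Let_def J by simp
qed

lemma indep_free_product: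
  assumes "q_matroid M1" "q_matroid M2"
  shows "indep (free_product M1 M2) I \<longleftrightarrow> free_indep M1 M2 I"
proof -
  interpret p: vector_space "dsum_scale M1 M2"
    using assms by (intro vector_space_dsum_scale q_matroid_vector_space)
  have finE: "finite (ground M1 \<times> ground M2)"
    using assms by (simp add: q_matroid_finite)
  let ?D = "{p.dim J | J. J \<subseteq> I \<and> free_indep M1 M2 J}"
  show ?thesis
  proof (cases "I \<in> subspaces (free_product M1 M2)")
    case True
    then have sub: "p.subspace I" "I \<subseteq> ground M1 \<times> ground M2"
      by (auto simp: subspaces_def free_product_def)
    have finI: "finite I" using sub(2) finE by (rule finite_subset)
    have le: "d \<le> p.dim I" if "d \<in> ?D" for d
      using that p.dim_mono_finite[OF finI] by auto
    have fin: "finite ?D" by (rule finite_subset[of _ "{..p.dim I}"]) (use le in auto)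
    have ne: "?D \<noteq> {}"
      using free_indep_0[OF assms] p.subspace_0[OF sub(1)] by blast
    have "Max ?D = p.dim I \<longleftrightarrow> free_indep M1 M2 I"
    proof
      assume "Max ?D = p.dim I"
      then obtain J where J: "J \<subseteq> I" "free_indep M1 M2 J" "p.dim J = p.dim I"
        using Max_in[OF fin ne] by auto
      obtain B where B: "B \<subseteq> J" "p.independent B" "J \<subseteq> p.span B" "card B = p.dim J"
        using p.basis_exists by blast
      have "I \<subseteq> p.span B"
      proof
        fix x assume x: "x \<in> I"
        show "x \<in> p.span B"
        proof (rule ccontr)
          assume nx: "x \<notin> p.span B"
          then have "p.independent (insert x B)" using B(2) by (simp add: p.independent_insertI)
          then have "p.dim (insert x B) = card (insert x B)" by (rule p.dim_eq_card_independent)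
          moreover have "finite B" "x \<notin> B"
            using B(1) J(1) finI nx p.span_base[of x B] by (meson finite_subset, blast)
          moreover have "p.dim (insert x B) \<le> p.dim I"
            using x B(1) J(1) by (intro p.dim_mono_finite finI) auto
          ultimately show False using B(4) J(3) by simp
        qed
      qed
      also have "\<dots> \<subseteq> J"
        using B(1) J(2) by (intro p.span_minimal) (auto simp: free_indep_def)
      finally show "free_indep M1 M2 I" using J by auto
    next
      assume "free_indep M1 M2 I"
      then show "Max ?D = p.dim I" using le fin by (intro Max_eqI) auto
    qed
    with True show ?thesis by (simp add: indep_def free_product_def)
  next
    case False
    then show ?thesis by (auto simp: indep_def subspaces_def free_product_def free_indep_def)
  qed
qed

lemma q_matroid_rk_eq_Max:
  assumes M: "q_matroid M" and A: "A \<in> subspaces M"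
  shows "rk M A = int (Max {qdim M I | I. I \<subseteq> A \<and> indep M I})"
proof -
  interpret vector_space "qscale M" using M by (rule q_matroid_vector_space)
  have r1: "\<And>A. A \<in> subspaces M \<Longrightarrow> 0 \<le> rk M A \<and> rk M A \<le> int (dim A)"
    and r2: "\<And>A B. A \<in> subspaces M \<Longrightarrow> B \<in> subspaces M \<Longrightarrow> A \<subseteq> B \<Longrightarrow> rk M A \<le> rk M B"
    and r3: "\<And>A B. A \<in> subspaces M \<Longrightarrow> B \<in> subspaces M \<Longrightarrow>
        rk M {a + b | a b. a \<in> A \<and> b \<in> B} + rk M (A \<inter> B) \<le> rk M A + rk M B"
    by (rule q_matroid_rk_bounds[OF M] q_matroid_rk_mono[OF M] q_matroid_rk_submodular[OF M]; assumption)+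
  have sA: "subspace A" and AE: "A \<subseteq> ground M" using A by (auto simp: subspaces_def)
  have finA: "finite A" using AE q_matroid_finite[OF M] by (rule finite_subset)
  let ?D = "{dim I | I. I \<subseteq> A \<and> indep M I}"
  have le: "d \<le> dim A" if "d \<in> ?D" for d
    using that dim_mono_finite[OF finA] by auto
  have fin: "finite ?D" by (rule finite_subset[of _ "{..dim A}"]) (use le in auto)
  have "dim {0} = 0"
    using dim_span[of "{}"] dim_eq_card_independent[OF independent_empty] by simp
  moreover have z: "{0} \<in> subspaces M"
    using A subspace_0[OF sA] by (auto simp: subspaces_def)
  ultimately have "indep M {0}" using r1[OF z] by (simp add: indep_def)
  then have ne: "?D \<noteq> {}" using subspace_0[OF sA] by blast
  obtain I where I: "I \<subseteq> A" "indep M I" "dim I = Max ?D"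
    using Max_in[OF fin ne] by auto
  have sI: "subspace I" and IE: "I \<in> subspaces M" and rI: "rk M I = int (dim I)"
    using I(2) by (auto simp: indep_def subspaces_def)
  have spI: "span I = I" using sI by (simp only: span_eq_iff)
  have span_in: "span C \<in> subspaces M" if "C \<subseteq> A" for C
    using span_minimal[OF that sA] AE by (auto simp: subspaces_def)
  have one: "rk M (span (insert x I)) = rk M I" if x: "x \<in> A" for x
  proof (cases "x \<in> I")
    case True
    then show ?thesis by (simp add: insert_absorb spI)
  next
    case False
    have J: "span (insert x I) \<in> subspaces M" using x I(1) by (intro span_in) auto
    have JA: "span (insert x I) \<subseteq> A" using x I(1) sA by (intro span_minimal) auto
    obtain B where B: "B \<subseteq> I" "independent B" "I \<subseteq> span B" "card B = dim I"
      using basis_exists by blast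
    have sB: "span B = I" using B sI span_minimal by blast
    have finB: "finite B" using B(1) I(1) finA by (meson finite_subset)
    have "span (insert x I) = span (insert x B)"
      using sB by (metis span_insert span_span)
    moreover have "independent (insert x B)" using False sB B(2) by (simp add: independent_insertI)
    ultimately have "dim (span (insert x I)) = card (insert x B)"
      by (metis dim_span dim_eq_card_independent)
    also have "\<dots> = Suc (dim I)"
      using card_insert_disjoint[OF finB, of x] B(1,4) False by auto
    finally have d: "dim (span (insert x I)) = Suc (dim I)" .
    have "\<not> indep M (span (insert x I))"
    proof
      assume "indep M (span (insert x I))"
      then have "dim (span (insert x I)) \<in> ?D" using JA by blast
      then have "dim (span (insert x I)) \<le> Max ?D" by (rule Max_ge[OF fin])
      then show False unfolding d I(3)[symmetric] by simp
    qed
    then have "rk M (span (insert x I)) \<noteq> int (Suc (dim I))" using J d by (simp add: indep_def)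
    moreover have "rk M (span (insert x I)) \<le> int (Suc (dim I))" using r1[OF J] d by simp
    moreover have "rk M I \<le> rk M (span (insert x I))"
      using r2[OF IE J] span_superset by blast
    ultimately show ?thesis using rI by simp
  qed
  have all: "rk M (span (I \<union> C)) = rk M I" if "finite C" "C \<subseteq> A" for C
    using that
  proof (induction C rule: finite_induct)
    case empty
    then show ?case by (simp add: spI)
  next
    case (insert x C)
    let ?P = "span (I \<union> C)" and ?Q = "span (insert x I)"
    have x: "x \<in> A" using insert.prems by simp
    have P: "?P \<in> subspaces M" and Q: "?Q \<in> subspaces M"
      and PQ: "span (I \<union> insert x C) \<in> subspaces M"
      using insert.prems I(1) by (auto intro!: span_in)
    have "span (I \<union> insert x C) = span ((I \<union> C) \<union> (insert x I))"
      by (rule arg_cong[of _ _ span]) auto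
    also have "\<dots> = {a + b | a b. a \<in> ?P \<and> b \<in> ?Q}" by (rule span_Un)
    finally have eq: "span (I \<union> insert x C) = {a + b | a b. a \<in> ?P \<and> b \<in> ?Q}" .
    have int: "?P \<inter> ?Q \<in> subspaces M"
      using P Q by (auto simp: subspaces_def intro: subspace_inter)
    have "I \<subseteq> ?P \<inter> ?Q" by (auto intro: span_base)
    then have "rk M I \<le> rk M (?P \<inter> ?Q)" using r2[OF IE int] by simp
    moreover have "rk M (span (I \<union> insert x C)) + rk M (?P \<inter> ?Q) \<le> rk M ?P + rk M ?Q"
      using r3[OF P Q] eq by simp
    moreover have "rk M I \<le> rk M (span (I \<union> insert x C))"
      using r2[OF IE PQ] by (auto intro: span_base)
    ultimately show ?case using insert.IH insert.prems one[OF x] by simp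
  qed
  have "span (I \<union> A) = A" using I(1) sA by (simp only: Un_absorb1 span_eq_iff)
  then have "rk M A = rk M I" using all[OF finA] by simp
  then show ?thesis using rI I(3) by simp
qed

lemma rk_free_product_unique:
  assumes "q_matroid N" "qscale N = dsum_scale M1 M2" "ground N = ground M1 \<times> ground M2"
    and "\<And>I. indep N I \<longleftrightarrow> free_indep M1 M2 I" and "A \<in> subspaces N"
  shows "rk N A = rk (free_product M1 M2) A"
  using q_matroid_rk_eq_Max[OF assms(1,5)] assms(2,4) by (simp add: free_product_def)

end

theory Submission
  imports Defs
begin

text \<open>The independent spaces of the free product are the spaces of dimension at most two that
  are not planes inside \<open>E\<^sub>1\<close>. So its rank function is \<open>min 1 dim\<close> on subspaces of \<open>E\<^sub>1\<close> and
  \<open>min 2 dim\<close> on all other subspaces. In a system of rank two a nonzero subspace has rank one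
  exactly when it lies in a point of the projective line. Hence an isomorphism onto a system
  \<open>S\<close> carries \<open>E\<^sub>1\<close> onto the intersection of \<open>S\<close> with a point of weight \<open>n\<^sub>1\<close>, and the
  remaining rank conditions say precisely that every other point has weight one. Conversely, for
  a club any linear isomorphism that carries \<open>E\<^sub>1\<close> onto the heavy part of \<open>S\<close> preserves ranks.\<close>

section \<open>Linear algebra: points, flags of subspaces and subspaces of a product\<close>

lemma (in vector_space) dim_eq_1E:
  assumes "dim V = 1"
  obtains v where "v \<in> V" "v \<noteq> 0" "V \<subseteq> span {v}"
proof -
  obtain B where B: "B \<subseteq> V" "independent B" "V \<subseteq> span B" "card B = dim V"
    by (rule basis_exists)
  then obtain v where "B = {v}" using assms by (metis card_1_singletonE)
  with B show thesis using that dependent_zero by auto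
qed

text \<open>Over the large field this says that two points with a common nonzero vector
  coincide.\<close>

lemma (in vector_space) span_singleton_eqI:
  assumes "v \<in> span {u}" "v \<noteq> 0"
  shows "span {v} = span {u}"
proof -
  obtain c where c: "v = scale c u" using assms(1) by (auto simp: span_singleton)
  then have "u = scale (inverse c) v" using assms(2) by auto
  then have "u \<in> span {v}" by (auto simp: span_singleton)
  then show ?thesis using assms(1) by (simp add: span_eq)
qed

lemma (in finite_dimensional_vector_space) dim_pos_iff: "0 < dim V \<longleftrightarrow> (\<exists>v\<in>V. v \<noteq> 0)"
  using dim_eq_0[of V] by (auto simp: neq0_conv[symmetric] simp del: neq0_conv)

text \<open>A basis \<open>B\<close> of \<open>U\<close> extends to a basis \<open>C\<close> of
  \<open>V\<close>, and likewise on the other side. A bijection of the large bases that matches the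
  small ones extends to a linear map respecting both levels. It is injective because it carries a
  basis onto an independent set.\<close>

lemma (in finite_dimensional_vector_space_pair) flag_isomorphism:
  assumes "U \<subseteq> V" "U' \<subseteq> V'"
    and U: "vs1.subspace U" "vs2.subspace U'" and V: "vs1.subspace V" "vs2.subspace V'"
    and dims: "vs1.dim U = vs2.dim U'" "vs1.dim V = vs2.dim V'"
  obtains f where "Vector_Spaces.linear s1 s2 f" "f ` U = U'" "f ` V = V'" "inj_on f V"
proof -
  obtain B where B: "B \<subseteq> U" "vs1.independent B" "U \<subseteq> vs1.span B" "card B = vs1.dim U"
    by (rule vs1.basis_exists)
  obtain C where C: "B \<subseteq> C" "C \<subseteq> V" "vs1.independent C" "V \<subseteq> vs1.span C"
    using vs1.maximal_independent_subset_extend[of B V] B assms(1) by blast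
  obtain B' where B': "B' \<subseteq> U'" "vs2.independent B'" "U' \<subseteq> vs2.span B'" "card B' = vs2.dim U'"
    by (rule vs2.basis_exists)
  obtain C' where C': "B' \<subseteq> C'" "C' \<subseteq> V'" "vs2.independent C'" "V' \<subseteq> vs2.span C'"
    using vs2.maximal_independent_subset_extend[of B' V'] B' assms(2) by blast
  have fin: "finite B" "finite C" "finite B'" "finite C'"
    using B B' C C' by (auto intro: vs1.finiteI_independent vs2.finiteI_independent)
  have card: "card B = card B'" "card C = card C'"
    using B(4) B'(4) dims vs1.basis_card_eq_dim[OF C(2,4,3)] vs2.basis_card_eq_dim[OF C'(2,4,3)]
    by simp_all
  then have "card (C - B) = card (C' - B')"
    using fin C(1) C'(1) by (simp add: card_Diff_subset)
  then obtain g1 g2 where g1: "bij_betw g1 B B'" and g2: "bij_betw g2 (C - B) (C' - B')"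
    using card fin finite_same_card_bij[of B B'] finite_same_card_bij[of "C - B" "C' - B'"] by blast
  define g where "g x = (if x \<in> B then g1 x else g2 x)" for x
  have gB: "bij_betw g B B'"
    using g1 by (subst bij_betw_cong[of B g g1]) (simp_all add: g_def)
  have "bij_betw g (C - B) (C' - B')"
    using g2 by (subst bij_betw_cong[of "C - B" g g2]) (simp_all add: g_def)
  with gB have "bij_betw g (B \<union> (C - B)) (B' \<union> (C' - B'))"
    by (rule bij_betw_combine) auto
  then have gC: "bij_betw g C C'" using C(1) C'(1) by (simp add: Un_absorb1)
  define f where "f = construct C g"
  have lin: "Vector_Spaces.linear s1 s2 f" unfolding f_def using C(3) by (rule linear_construct)
  have fg: "f b = g b" if "b \<in> C" for b
    unfolding f_def using C(3) that by (rule construct_basis)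
  have "f ` B = g ` B" using C(1) fg by (intro image_cong) auto
  then have fB: "f ` B = B'" using gB by (simp add: bij_betw_def)
  have "bij_betw f C C'" using gC fg by (simp cong: bij_betw_cong)
  then have fC: "f ` C = C'" and inj: "inj_on f C" by (simp_all add: bij_betw_def)
  have spans: "vs1.span B = U" "vs1.span C = V" "vs2.span B' = U'" "vs2.span C' = V'"
    using B C B' C' U V by (meson subset_antisym vs1.span_minimal vs2.span_minimal)+
  show thesis
  proof
    show "Vector_Spaces.linear s1 s2 f" by (fact lin)
    show "f ` U = U'" "f ` V = V'"
      using linear_span_image[OF lin, of B] linear_span_image[OF lin, of C] fB fC spans by simp_all
    show "inj_on f V"
      using linear_inj_on_span_independent_image[OF lin _ inj] fC C'(3) spans(2) by simp
  qed
qed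

lemma (in vector_space_prod) subspace_fibre:
  "p.subspace I \<Longrightarrow> vs1.subspace {x. (x, 0) \<in> I}"
  by (auto simp: vs1.subspace_def p.subspace_def zero_prod_def scale_def)
    (metis (no_types, lifting) add_Pair add.right_neutral,
     metis (no_types, lifting) fst_conv snd_conv vs2.scale_zero_right)

lemma (in finite_dimensional_vector_space_prod) dim_eq_dim_fibre_plus_dim_snd:
  assumes I: "p.subspace I"
  shows "p.dim I = vs1.dim {x. (x, 0) \<in> I} + vs2.dim (snd ` I)"
proof -
  interpret snd: Vector_Spaces.linear scale s2 snd by (fact linear_snd)
  let ?J = "{x. (x, 0) \<in> I}"
  have z: "vs2.subspace {0}" "vs2.dim {0} = 0" by simp_all
  have J: "vs1.subspace ?J" using I by (rule subspace_fibre)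
  have K: "vs2.subspace (snd ` I)" using I by (rule snd.subspace_image)
  have E: "p.subspace (UNIV \<times> {0})" using subspace_Times[OF vs1.subspace_UNIV z(1)] .
  have "{x + y | x y. x \<in> I \<and> y \<in> UNIV \<times> {0}} = UNIV \<times> snd ` I"
  proof (intro equalityI subsetI)
    fix u :: "'b \<times> 'c" assume "u \<in> UNIV \<times> snd ` I"
    then obtain x where x: "x \<in> I" "snd x = snd u" by auto
    then have "u = x + (fst u - fst x, 0)" by (simp add: prod_eq_iff)
    with x(1) show "u \<in> {x + y | x y. x \<in> I \<and> y \<in> UNIV \<times> {0}}" by blast
  qed force
  moreover have "I \<inter> UNIV \<times> {0} = ?J \<times> {0}" by auto
  ultimately show ?thesis
    using p.dim_sums_Int[OF I E] dim_Times[OF vs1.subspace_UNIV K] dim_Times[OF J z(1)]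
      dim_Times[OF vs1.subspace_UNIV z(1)] z(2) by simp
qed

interpretation vec_prod: finite_dimensional_vector_space_prod
  "(*s) :: 'a::field \<Rightarrow> 'a ^ 'm \<Rightarrow> _" "(*s) :: 'a::field \<Rightarrow> 'a ^ 'n \<Rightarrow> _"
  cart_basis cart_basis ..

section \<open>The free product of two uniform q-matroids of rank one\<close>

lemma dsum_scale_uniform: "dsum_scale (uniform k) (uniform l) = vec_prod.scale"
  by (simp add: dsum_scale_def uniform_def)

lemma free_indep_uniform_1:
  fixes I :: "(('k::{field,finite} ^ 'n1) \<times> ('k ^ 'n2)) set"
  shows "free_indep (uniform 1) (uniform 1) I \<longleftrightarrow>
    vec_prod.p.subspace I \<and> vec_prod.p.dim I \<le> 2 \<and>
    (I \<subseteq> UNIV \<times> {0} \<longrightarrow> vec_prod.p.dim I \<le> 1)"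
proof (cases "vec_prod.p.subspace I")
  case True
  let ?J = "{x. (x, 0) \<in> I}"
  have J: "vec.subspace ?J" using True by (rule vec_prod.subspace_fibre)
  have eq: "fst ` (I \<inter> (\<lambda>x. (x, 0)) ` ground (uniform 1)) = ?J"
    by (force simp: uniform_def)
  have d: "vec_prod.p.dim I = vec.dim ?J + vec.dim (snd ` I)"
    by (rule vec_prod.dim_eq_dim_fibre_plus_dim_snd[OF True])
  have sub: "I \<subseteq> UNIV \<times> {0} \<longleftrightarrow> vec.dim (snd ` I) = 0"
    by (subst vec.dim_eq_0) (force simp: image_subset_iff)
  have "free_indep (uniform 1) (uniform 1) I \<longleftrightarrow>
      int (min 1 (vec.dim ?J)) = int (vec.dim ?J) \<and>
      int (vec.dim (snd ` I)) - int (min 1 (vec.dim (snd ` I))) \<le>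
        int (min 1 CARD('n1)) - int (min 1 (vec.dim ?J))"
    using True J unfolding free_indep_def Let_def eq
    by (auto simp: uniform_def dsum_scale_def indep_def subspaces_def lam_def nullity_def
        card_cart_basis simp del: of_nat_min)
  also have "\<dots> \<longleftrightarrow> vec_prod.p.dim I \<le> 2 \<and> (I \<subseteq> UNIV \<times> {0} \<longrightarrow> vec_prod.p.dim I \<le> 1)"
    \<comment> \<open>Positivity of \<open>CARD('n1)\<close> makes the rank of the first ground
      space equal to 1.\<close>
    unfolding sub d using zero_less_card_finite[where 'a='n1]
    by (cases "vec.dim (snd ` I) = 0") (auto simp: min_def simp del: vec.dim_eq_0)
  finally show ?thesis using True by simp
next
  case False
  then show ?thesis by (simp add: free_indep_def uniform_def dsum_scale_def)
qed

lemma rk_free_product_uniform_1: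
  fixes A :: "(('k::{field,finite} ^ 'n1) \<times> ('k ^ 'n2)) set"
  assumes A: "vec_prod.p.subspace A"
  shows "rk (free_product (uniform 1) (uniform 1)) A =
    int (min (if A \<subseteq> UNIV \<times> {0} then 1 else 2) (vec_prod.p.dim A))" (is "_ = int ?r")
proof -
  let ?D = "{vec_prod.p.dim I | I. I \<subseteq> A \<and> free_indep (uniform 1) (uniform 1) I}"
  have "Max ?D = ?r"
  proof (rule Max_eqI)
    show le: "d \<le> ?r" if d: "d \<in> ?D" for d
    proof -
      obtain I where I: "I \<subseteq> A" "free_indep (uniform 1) (uniform 1) I" "d = vec_prod.p.dim I"
        using d by blast
      then show ?thesis
        using vec_prod.p.dim_subset[OF I(1)] unfolding free_indep_uniform_1 by auto
    qed
    have "?D \<subseteq> {..?r}" using le by blast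
    then show "finite ?D" by (rule finite_subset) simp
    have "\<exists>I. vec_prod.p.subspace I \<and> I \<subseteq> A \<and> vec_prod.p.dim I = ?r \<and>
        (I \<subseteq> UNIV \<times> {0} \<longrightarrow> vec_prod.p.dim I \<le> 1)"
    proof (cases "A \<subseteq> UNIV \<times> {0} \<or> vec_prod.p.dim A \<le> 1")
      case True
      \<comment> \<open>Here \<open>?r\<close> is at most 1, so every subspace of \<open>A\<close>
        of that dimension is independent.\<close>
      have "?r \<le> vec_prod.p.dim A" by simp
      then obtain I where "vec_prod.p.subspace I" "I \<subseteq> vec_prod.p.span A" "vec_prod.p.dim I = ?r"
        by (rule vec_prod.p.choose_subspace_of_subspace)
      moreover have "vec_prod.p.span A = A" using A by simp
      moreover have "?r \<le> 1" using True by (auto simp: min_def)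
      ultimately show ?thesis by (intro exI[of _ I]) simp
    next
      case False
      then obtain x where x: "x \<in> A" "x \<notin> UNIV \<times> {0}" by blast
      \<comment> \<open>Now \<open>A\<close> has dimension at least 2, so some \<open>y\<close>
        completes \<open>x\<close> to a plane. The choice of \<open>x\<close> keeps this plane from
        lying in the first summand.\<close>
      have "\<not> A \<subseteq> vec_prod.p.span {x}"
        using vec_prod.p.dim_mono[of A "{x}"] False by (auto split: if_splits)
      then obtain y where y: "y \<in> A" "y \<notin> vec_prod.p.span {x}" by blast
      let ?I = "vec_prod.p.span {x, y}"
      have "x \<noteq> 0" using x(2) by (auto simp: zero_prod_def)
      then have "vec_prod.p.dim ?I = 2"
        using y(2) vec_prod.p.dim_insert[of y "{x}"] by (simp add: insert_commute)
      moreover have "?I \<subseteq> A" using x y A by (intro vec_prod.p.span_minimal) auto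
      moreover have "x \<in> ?I" by (simp add: vec_prod.p.span_base)
      moreover have "?r = 2" using False by auto
      ultimately show ?thesis using x(2) by (intro exI[of _ ?I]) auto
    qed
    then obtain I where I: "vec_prod.p.subspace I" "I \<subseteq> A" "vec_prod.p.dim I = ?r"
      "I \<subseteq> UNIV \<times> {0} \<longrightarrow> vec_prod.p.dim I \<le> 1" by blast
    moreover have "?r \<le> 2" by auto
    ultimately have "free_indep (uniform 1) (uniform 1) I"
      unfolding free_indep_uniform_1 by simp
    with I(2,3) show "?r \<in> ?D" by (intro CollectI exI[of _ I]) simp
  qed
  then show ?thesis
    by (simp add: free_product_def dsum_scale_uniform del: One_nat_def)
qed

text \<open>For submodularity the critical case is that exactly one of \<open>A\<close> and
  \<open>B\<close> lies in the first summand \<open>?E\<close>. The sum then has cap 2 while one of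
  the two spaces has cap 1. The space outside \<open>?E\<close> has positive dimension, and it
  properly contains the intersection, which makes up for the difference.\<close>

lemma q_matroid_free_product_uniform_1:
  "q_matroid (free_product (uniform 1 :: ('k::{field,finite}, 'k ^ 'n1) qmat)
     (uniform 1 :: ('k, 'k ^ 'n2) qmat))"
    (is "q_matroid ?M")
proof -
  let ?E = "UNIV \<times> {0} :: (('k ^ 'n1) \<times> ('k ^ 'n2)) set"
  have q: "qscale ?M = vec_prod.scale" and g: "ground ?M = UNIV"
    by (simp_all add: free_product_def uniform_def dsum_scale_def)
  have s: "subspaces ?M = {A. vec_prod.p.subspace A}"
    unfolding subspaces_def q g by simp
  have submod: "rk ?M {a + b | a b. a \<in> A \<and> b \<in> B} + rk ?M (A \<inter> B) \<le> rk ?M A + rk ?M B"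
    if A: "vec_prod.p.subspace A" and B: "vec_prod.p.subspace B" for A B
  proof -
    let ?S = "{a + b | a b. a \<in> A \<and> b \<in> B}"
    let ?d = "vec_prod.p.dim :: (('k ^ 'n1) \<times> ('k ^ 'n2)) set \<Rightarrow> nat"
    have dims: "?d ?S + ?d (A \<inter> B) = ?d A + ?d B"
      using A B by (rule vec_prod.p.dim_sums_Int)
    have le: "?d (A \<inter> B) \<le> ?d A" "?d (A \<inter> B) \<le> ?d B"
      by (auto intro: vec_prod.p.dim_subset)
    \<comment> \<open>This determines which cap, 1 or 2, applies to the sum.\<close>
    have sub: "?S \<subseteq> ?E \<longleftrightarrow> A \<subseteq> ?E \<and> B \<subseteq> ?E"
    proof
      assume S: "?S \<subseteq> ?E"
      have "x \<in> ?S" if "x \<in> A" for x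
        using that vec_prod.p.subspace_0[OF B] by (intro CollectI exI[of _ x] exI[of _ 0]) simp
      moreover have "x \<in> ?S" if "x \<in> B" for x
        using that vec_prod.p.subspace_0[OF A] by (intro CollectI exI[of _ 0] exI[of _ x]) simp
      ultimately show "A \<subseteq> ?E \<and> B \<subseteq> ?E" using S by blast
    qed fastforce
    have pos: "0 < ?d C" if "\<not> C \<subseteq> ?E" for C
      using that by (fastforce simp: vec_prod.p.dim_pos_iff zero_prod_def)
    have S: "vec_prod.p.subspace ?S" and I: "vec_prod.p.subspace (A \<inter> B)"
      using A B by (rule vec_prod.p.subspace_sums vec_prod.p.subspace_inter)+
    have sp: "vec_prod.p.span A = A" "vec_prod.p.span B = B" "vec_prod.p.span (A \<inter> B) = A \<inter> B"
      using A B I by (simp_all only: vec_prod.p.span_eq_iff)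
    have ltA: "?d (A \<inter> B) < ?d A" if "\<not> A \<subseteq> ?E" "B \<subseteq> ?E"
      by (rule vec_prod.p.dim_psubset) (unfold sp, use that in blast)
    have ltB: "?d (A \<inter> B) < ?d B" if "A \<subseteq> ?E" "\<not> B \<subseteq> ?E"
      by (rule vec_prod.p.dim_psubset) (unfold sp, use that in blast)
    have I': "A \<subseteq> ?E \<Longrightarrow> A \<inter> B \<subseteq> ?E" "B \<subseteq> ?E \<Longrightarrow> A \<inter> B \<subseteq> ?E" by blast+
    show ?thesis
      unfolding rk_free_product_uniform_1[OF S] rk_free_product_uniform_1[OF I]
        rk_free_product_uniform_1[OF A] rk_free_product_uniform_1[OF B] of_nat_add[symmetric] of_nat_le_iff
      using dims le sub pos[of A] pos[of B] ltA ltB I'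
      by (cases "A \<subseteq> ?E"; cases "B \<subseteq> ?E"; cases "A \<inter> B \<subseteq> ?E") (simp_all add: min_def)
  qed
  have "rk ?M A \<le> rk ?M B"
    if "vec_prod.p.subspace A" "vec_prod.p.subspace B" "A \<subseteq> B" for A B
    using that vec_prod.p.dim_subset[of A B]
    unfolding rk_free_product_uniform_1[OF that(1)] rk_free_product_uniform_1[OF that(2)] by auto
  moreover have "vector_space (vec_prod.scale :: 'k \<Rightarrow> ('k ^ 'n1) \<times> ('k ^ 'n2) \<Rightarrow> _)"
    by (rule vec_prod.p.vector_space_axioms)
  moreover have "\<exists>B. finite B \<and> UNIV = vec_prod.p.span (B :: (('k ^ 'n1) \<times> ('k ^ 'n2)) set)"
    by (rule exI[of _ UNIV]) simp
  ultimately show ?thesis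
    using submod unfolding q_matroid_def s q g by (simp add: rk_free_product_uniform_1 del: One_nat_def)
qed

section \<open>Clubs\<close>

text \<open>Supplies the basis needed to use finite-dimensional theory over the small field, where
  \<open>res_scale \<phi>\<close> comes with no distinguished basis.\<close>

lemma (in vector_space) ex_finite_Basis:
  assumes "finite (UNIV :: 'b set)"
  shows "\<exists>B. finite_dimensional_vector_space scale B"
proof -
  obtain B where "B \<subseteq> UNIV" "independent B" "UNIV \<subseteq> span B" "card B = dim UNIV"
    by (rule basis_exists)
  moreover have "finite B" using assms by (rule rev_finite_subset) simp
  ultimately have "finite_dimensional_vector_space scale B"
    by unfold_locales auto
  then show ?thesis ..
qed

text \<open>A span over the large field is also a subspace over the small one. A basis of
  \<open>V\<close> over the small field therefore spans \<open>V\<close> over the large field as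
  well.\<close>

lemma vec_dim_le_res_dim:
  fixes \<phi> :: "'k::field \<Rightarrow> 'l::field" and V :: "('l ^ 'r) set"
  assumes "field_embedding \<phi>" "finite V"
  shows "vec.dim V \<le> vector_space.dim (res_scale \<phi>) V"
proof -
  interpret r: vector_space "res_scale \<phi> :: 'k \<Rightarrow> 'l ^ 'r \<Rightarrow> _"
    using assms(1) by (rule vector_space_res_scale)
  obtain B where B: "B \<subseteq> V" "r.independent B" "V \<subseteq> r.span B" "card B = r.dim V"
    by (rule r.basis_exists)
  have "r.subspace (vec.span B)"
    by (auto simp: r.subspace_def res_scale_def vec.span_zero vec.span_add vec.span_scale)
  then have "r.span B \<subseteq> vec.span B"
    by (intro r.span_minimal) (auto intro: vec.span_base)
  with B(3) have "vec.dim V \<le> card B"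
    using finite_subset[OF B(1) assms(2)] by (intro vec.dim_le_card) auto
  then show ?thesis using B(4) by simp
qed

text \<open>Both sides contain the same condition that \<open>S\<close> is a system of dimension
  \<open>CARD('n1) + CARD('n2)\<close>. What remains is to compare the rank function with the
  weights of points.\<close>

theorem represents_free_product_uniform_1_iff_club:
  fixes \<phi> :: "'k::{field,finite} \<Rightarrow> 'l::{field,finite}" and S :: "('l ^ 2) set"
  assumes \<phi>: "field_embedding \<phi>"
  shows "represents \<phi> S
      (free_product (uniform 1 :: ('k, 'k ^ 'n1) qmat) (uniform 1 :: ('k, 'k ^ 'n2) qmat))
    \<longleftrightarrow> is_club \<phi> CARD('n1) (CARD('n1) + CARD('n2)) S"
    (is "represents \<phi> S ?M \<longleftrightarrow> _")
proof -
  interpret r: vector_space "res_scale \<phi> :: 'k \<Rightarrow> 'l ^ 2 \<Rightarrow> _"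
    using \<phi> by (rule vector_space_res_scale)
  obtain Bs where "finite_dimensional_vector_space (res_scale \<phi> :: 'k \<Rightarrow> 'l ^ 2 \<Rightarrow> _) Bs"
    using r.ex_finite_Basis by auto
  then interpret r: finite_dimensional_vector_space "res_scale \<phi> :: 'k \<Rightarrow> 'l ^ 2 \<Rightarrow> _" Bs .
  interpret pr: finite_dimensional_vector_space_pair
    "vec_prod.scale :: 'k \<Rightarrow> ('k ^ 'n1) \<times> ('k ^ 'n2) \<Rightarrow> _" vec_prod.Basis_pair "res_scale \<phi>" Bs ..
  let ?E = "UNIV \<times> {0} :: (('k ^ 'n1) \<times> ('k ^ 'n2)) set"
  have q: "qscale ?M = vec_prod.scale" and g: "ground ?M = UNIV"
    by (simp_all add: free_product_def uniform_def dsum_scale_def)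
  have s: "subspaces ?M = {A. vec_prod.p.subspace A}"
    unfolding subspaces_def q g by simp
  have E: "vec_prod.p.subspace ?E" "vec_prod.p.dim ?E = CARD('n1)"
    using vec_prod.subspace_Times[OF vec.subspace_UNIV vec.subspace_single_0]
      vec_prod.dim_Times[OF vec.subspace_UNIV vec.subspace_single_0]
    by (simp_all add: card_cart_basis)
  have dU: "vec_prod.p.dim (UNIV :: (('k ^ 'n1) \<times> ('k ^ 'n2)) set) = CARD('n1) + CARD('n2)"
    using vec_prod.dim_Times[OF vec.subspace_UNIV vec.subspace_UNIV]
    by (simp add: card_cart_basis)
  have pos: "0 < CARD('n1)" "0 < CARD('n2)" by simp_all
  \<comment> \<open>Points are subspaces over the small field too, and so are their preimages and
    their intersections with \<open>S\<close>.\<close>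
  have point: "r.subspace (vec.span T)" for T
    by (auto simp: r.subspace_def res_scale_def vec.span_zero vec.span_add vec.span_scale)
  have N: "rk (system_qmat \<phi> S) V = int (vec.dim V)" "ground (system_qmat \<phi> S) = S"
    "qscale (system_qmat \<phi> S) = res_scale \<phi>" for V
    by (simp_all add: system_qmat_def)
  have sing: "vec.dim (vec.span {v}) \<le> 1" for v :: "'l ^ 2" by simp
  show ?thesis
  proof
    assume rep: "represents \<phi> S ?M"
    then have sys: "is_system \<phi> (CARD('n1) + CARD('n2)) S"
      unfolding represents_def q g dU by simp
    obtain f where bij: "bij_betw f UNIV S"
      and add: "\<And>x y. f (x + y) = f x + f y"
      and scale: "\<And>c x. f (vec_prod.scale c x) = res_scale \<phi> c (f x)"
      and rk: "\<And>A. vec_prod.p.subspace A \<Longrightarrow> int (vec.dim (f ` A)) = rk ?M A"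
      using rep unfolding represents_def qmat_iso_def N q g s by auto
    interpret f: Vector_Spaces.linear vec_prod.scale "res_scale \<phi>" f
      by unfold_locales (simp_all add: add scale)
    have inj: "inj f" and ran: "range f = S" using bij by (auto simp: bij_betw_def)
    have dim_image: "r.dim (f ` A) = vec_prod.p.dim A" for A
      using inj_on_subset[OF inj] by (intro pr.dim_image_eq f.linear_axioms) simp
    \<comment> \<open>Since \<open>?E\<close> is nonzero, its image has rank one and so lies in a
      single point. That point, spanned by \<open>v\<close>, is the candidate for weight
      \<open>CARD('n1)\<close>.\<close>
    have "vec.dim (f ` ?E) = 1"
      using rk[OF E(1)] rk_free_product_uniform_1[OF E(1)] pos E(2) by simp
    then obtain v where v: "v \<in> f ` ?E" "v \<noteq> 0" "f ` ?E \<subseteq> vec.span {v}"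
      by (rule vec.dim_eq_1E)
    \<comment> \<open>The dimension of \<open>pre u\<close> is the weight of the point of
      \<open>u\<close>. Its image has rank one, so the rank formula leaves only two options:
      \<open>pre u\<close> lies in \<open>?E\<close> or has dimension one.\<close>
    define pre where "pre u = f -` vec.span {u}" for u
    have pre: "f ` pre u = S \<inter> vec.span {u} \<and>
        weight \<phi> S (vec.span {u}) = vec_prod.p.dim (pre u) \<and>
        (pre u \<subseteq> ?E \<or> vec_prod.p.dim (pre u) = 1)"
      if u: "u \<in> S" "u \<noteq> 0" for u
    proof -
      let ?A = "pre u"
      have A: "vec_prod.p.subspace ?A" unfolding pre_def by (rule f.subspace_vimage[OF point])
      have fA: "f ` ?A = S \<inter> vec.span {u}" using ran by (auto simp: pre_def)
      have "vec.dim (f ` ?A) \<le> 1"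
        using vec.dim_subset[of "f ` ?A" "vec.span {u}"] sing[of u] fA by auto
      moreover have "0 < vec.dim (f ` ?A)"
        unfolding fA using u by (auto simp: vec.dim_pos_iff intro: vec.span_base)
      ultimately have "int (vec.dim (f ` ?A)) = 1" by linarith
      then have "min (if ?A \<subseteq> ?E then 1 else 2) (vec_prod.p.dim ?A) = 1"
        unfolding rk[OF A] rk_free_product_uniform_1[OF A] of_nat_eq_1_iff .
      then have "?A \<subseteq> ?E \<or> vec_prod.p.dim ?A = 1" by (cases "?A \<subseteq> ?E") auto
      moreover have "weight \<phi> S (vec.span {u}) = vec_prod.p.dim ?A"
        unfolding weight_def fA[symmetric] by (rule dim_image)
      ultimately show ?thesis by (intro conjI fA)
    qed
    have vS: "v \<in> S" using v(1) ran by auto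
    have sub: "?E \<subseteq> pre v" using v(3) unfolding pre_def by blast
    have "pre v \<subseteq> ?E \<or> vec_prod.p.dim (pre v) = 1" using pre[OF vS v(2)] by (elim conjE)
    then have "vec_prod.p.dim (pre v) = CARD('n1)"
    proof
      assume "pre v \<subseteq> ?E"
      then have "pre v = ?E" using sub by (rule subset_antisym)
      then show ?thesis using E(2) by simp
    next
      \<comment> \<open>As \<open>pre v\<close> contains \<open>?E\<close>, this forces
        \<open>CARD('n1)\<close> to be 1, so the weight is still as required.\<close>
      assume "vec_prod.p.dim (pre v) = 1"
      then show ?thesis
        using vec_prod.p.dim_subset[OF sub] E(2) pos(1) by linarith
    qed
    then have wP: "weight \<phi> S (vec.span {v}) = CARD('n1)" using pre[OF vS v(2)] by simp
    have wQ: "weight \<phi> S Q = 1" if Q: "Q \<in> linear_set S" "Q \<noteq> vec.span {v}" for Q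
    proof -
      obtain u where u: "u \<in> S" "u \<noteq> 0" "Q = vec.span {u}"
        using Q(1) by (auto simp: linear_set_def)
      \<comment> \<open>Otherwise \<open>u\<close> itself would lie in the point of
        \<open>v\<close>, and the two points would coincide.\<close>
      have "\<not> pre u \<subseteq> ?E"
      proof
        assume "pre u \<subseteq> ?E"
        then have "f ` pre u \<subseteq> vec.span {v}" using v(3) by blast
        moreover have "u \<in> f ` pre u"
          unfolding pre[OF u(1,2), THEN conjunct1] using u(1) by (simp add: vec.span_base)
        ultimately have "u \<in> vec.span {v}" by (rule subsetD)
        then show False using vec.span_singleton_eqI[OF _ u(2)] Q(2) u(3) by simp
      qed
      then show ?thesis using pre[OF u(1,2)] u(3) by simp
    qed
    have "vec.span {v} \<in> linear_set S" using vS v(2) by (auto simp: linear_set_def)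
    then show "is_club \<phi> CARD('n1) (CARD('n1) + CARD('n2)) S"
      unfolding is_club_def using sys wP wQ by blast
  next
    assume "is_club \<phi> CARD('n1) (CARD('n1) + CARD('n2)) S"
    then obtain P where sys: "is_system \<phi> (CARD('n1) + CARD('n2)) S"
      and "P \<in> linear_set S" and wP: "weight \<phi> S P = CARD('n1)"
      and wQ: "\<And>Q. Q \<in> linear_set S \<Longrightarrow> Q \<noteq> P \<Longrightarrow> weight \<phi> S Q = 1"
      unfolding is_club_def by blast
    then obtain v where P: "P = vec.span {v}" by (auto simp: linear_set_def)
    have S: "r.subspace S" "r.dim S = CARD('n1) + CARD('n2)"
      using sys by (simp_all add: is_system_def)
    \<comment> \<open>The flags \<open>?E\<close> in the whole space and \<open>S \<inter> P\<close>
      in \<open>S\<close> have equal dimensions: the weight of \<open>P\<close> is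
      \<open>CARD('n1)\<close>.\<close>
    obtain f where lin: "Vector_Spaces.linear vec_prod.scale (res_scale \<phi>) f"
      and fE: "f ` ?E = S \<inter> P" and ran: "range f = S" and inj: "inj f"
    proof (rule pr.flag_isomorphism[of ?E UNIV "S \<inter> P" S])
      show "r.subspace (S \<inter> P)" by (unfold P, intro r.subspace_inter S(1) point)
      show "vec_prod.p.dim ?E = r.dim (S \<inter> P)" using E(2) wP by (simp add: weight_def)
    qed (use S E dU in auto)
    interpret f: Vector_Spaces.linear vec_prod.scale "res_scale \<phi>" f by (fact lin)
    have fS: "f x \<in> S" for x using ran by blast
    have dim_image: "r.dim (f ` A) = vec_prod.p.dim A" for A
      using inj_on_subset[OF inj] by (intro pr.dim_image_eq f.linear_axioms) simp
    have rk: "vec.dim (f ` A) = min (if A \<subseteq> ?E then 1 else 2) (vec_prod.p.dim A)" for A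
    proof -
      \<comment> \<open>These bounds and \<open>ge\<close> leave only two things to check: rank at
        most 1 inside \<open>?E\<close>, and rank different from 1 for dimension at least 2 outside
        it.\<close>
      have le: "vec.dim (f ` A) \<le> vec_prod.p.dim A" "vec.dim (f ` A) \<le> 2"
        using vec_dim_le_res_dim[OF \<phi>, of "f ` A"] dim_image[of A] vec.dim_subset_UNIV[of "f ` A"]
        by (simp_all add: vec.dimension_def card_cart_basis)
      have ge: "0 < vec_prod.p.dim A \<longrightarrow> 0 < vec.dim (f ` A)"
        unfolding vec.dim_pos_iff dim_image[symmetric] r.dim_pos_iff ..
      show ?thesis
      proof (cases "A \<subseteq> ?E")
        case True
        then have "f ` A \<subseteq> P" using image_mono[OF True, of f] unfolding fE by simp
        then have "vec.dim (f ` A) \<le> 1"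
          using vec.dim_subset[of "f ` A" P] sing[of v] unfolding P by linarith
        then show ?thesis unfolding if_P[OF True] using le ge by arith
      next
        case False
        then obtain a where a: "a \<in> A" "a \<notin> ?E" by blast
        have "f a \<notin> f ` ?E" using a(2) inj by (simp only: inj_image_mem_iff simp_thms)
        then have fa: "f a \<notin> P" using fS[of a] unfolding fE by simp
        have "2 \<le> vec_prod.p.dim A \<longrightarrow> vec.dim (f ` A) \<noteq> 1"
        proof (intro impI notI)
          assume dim: "2 \<le> vec_prod.p.dim A"
          assume "vec.dim (f ` A) = 1"
          then obtain u where u: "u \<in> f ` A" "u \<noteq> 0" "f ` A \<subseteq> vec.span {u}"
            by (rule vec.dim_eq_1E)
          have "vec.span {u} \<in> linear_set S" using u(1,2) fS by (auto simp: linear_set_def)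
          moreover have "vec.span {u} \<noteq> P" using u(3) a(1) fa by auto
          ultimately have "r.dim (S \<inter> vec.span {u}) = 1"
            using wQ by (simp add: weight_def)
          moreover have "f ` A \<subseteq> S \<inter> vec.span {u}" using u(3) fS by auto
          ultimately have "vec_prod.p.dim A \<le> 1"
            using r.dim_subset[of "f ` A"] dim_image[of A] by metis
          then show False using dim by simp
        qed
        then show ?thesis unfolding if_not_P[OF False] using le ge by arith
      qed
    qed
    have "qmat_iso ?M (system_qmat \<phi> S)"
      unfolding qmat_iso_def N q g s using inj ran
      by (intro exI[of _ f])
        (auto simp: bij_betw_def f.add f.scale rk rk_free_product_uniform_1
          simp del: of_nat_min One_nat_def)
    \<comment> \<open>\<open>represents\<close> asks that the rank equal the dimension of the
      ambient space. The cap 2 applies because the second summand is nonzero, and it is reached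
      because both summands are nonzero.\<close>
    moreover have "rk ?M UNIV = int CARD(2)"
    proof -
      have "\<not> (UNIV :: (('k ^ 'n1) \<times> ('k ^ 'n2)) set) \<subseteq> ?E"
      proof
        assume "(UNIV :: (('k ^ 'n1) \<times> ('k ^ 'n2)) set) \<subseteq> ?E"
        then have "CARD('n1) + CARD('n2) \<le> CARD('n1)"
          using vec_prod.p.dim_subset[of UNIV ?E] E(2) dU by simp
        then show False using pos by simp
      qed
      moreover have "2 \<le> CARD('n1) + CARD('n2)" using pos by linarith
      ultimately show ?thesis
        unfolding rk_free_product_uniform_1[OF vec_prod.p.subspace_UNIV] dU by simp
    qed
    ultimately show "represents \<phi> S ?M"
      using q_matroid_free_product_uniform_1 sys unfolding represents_def q g dU by blast
  qed
qed

theorem theorem5p16: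
  fixes \<phi> :: "'k::{field,finite} \<Rightarrow> 'l::{field,finite}"
    and m :: nat
    and S1 S2 :: "('l ^ 1) set"
    and w :: "'n2::finite \<Rightarrow> 'l ^ 1"
    and X :: "'l ^ 'n2 ^ 1"
  assumes "field_embedding \<phi>"
    and "CARD('l) = CARD('k) ^ m"
    and "CARD('n1::finite) \<le> m"
    and "CARD('n2) \<le> m"
    and "represents \<phi> S1 (uniform 1 :: ('k, 'k ^ 'n1) qmat)"
    and "represents \<phi> S2 (uniform 1 :: ('k, 'k ^ 'n2) qmat)"
    and "is_basis \<phi> S2 w"
  shows "represents \<phi> (box_system \<phi> S1 X w)
           (free_product (uniform 1 :: ('k, 'k ^ 'n1) qmat) (uniform 1 :: ('k, 'k ^ 'n2) qmat))
         \<longleftrightarrow> is_club \<phi> CARD('n1) (CARD('n1) + CARD('n2)) (box_system \<phi> S1 X w)"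
  using assms(1) by (rule represents_free_product_uniform_1_iff_club)

end
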